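(* Let the abstract $hp$-framework, the routines $\mathbf{hp}$-$\mathbf{NEARBEST}$ (with constants $0<b\le 1\le B$) and $\mathbf{PDE}$, and the basic algorithm $\mathbf{hp}$-$\mathbf{AFEM}$ be as described in the context. Assume that there are constants $C_1,C_2>0$ with $C_1C_2<b$ such that $$\|u(f,\lambda)-u(f_{\mathcal D},\lambda_{\mathcal D})\|_V\le C_1\inf_{w\in V}E_{\mathcal D}(w,f,\lambda)^{1/2}\qquad\forall \mathcal D\in\mathbb D,\ \forall (f,\lambda)\in F\times\Lambda,$$ $$\sup_{(f,\lambda)\in F\times\Lambda}\big|E_{\mathcal D}(w,f,\lambda)^{1/2}-E_{\mathcal D}(v,f,\lambda)^{1/2}\big|\le C_2\|w-v\|_V\qquad\forall\mathcal D\in\mathbb D,\ \forall v,w\in V.$$ Let $(f,\lambda)\in F\times\Lambda$, $u:=u(f,\lambda)$, $\bar u_0\in V$, $\varepsilon_0>0$ with $\|u-\bar u_0\|_V\le\varepsilon_0$, and let $\mu\in(0,1)$, $\omega>0$ satisfy $C_1C_2<b(1-\mu)$ and $\omega\in\big(\tfrac{C_2}{b},\tfrac{1-\mu}{C_1}\big)$. Then the sequences $(\bar u_i)$, $(\mathcal D_i)$ produced by $\mathbf{hp}$-$\mathbf{AFEM}$, with $\varepsilon_i=(\mu+C_1\omega)^i\varepsilon_0$, satisfy $$\|u-\bar u_i\|_V\le\varepsilon_i\quad\forall i\ge0,\qquad E_{\mathcal D_i}(u,f,\lambda)^{1/2}\le(\omega+C_2)\varepsilon_{i-1}\quad\forall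 i\ge1,$$ and, for all $i\ge 1$, $$\#\mathcal D_i\le B\,\#\mathcal D\quad\text{for any }\mathcal D\in\mathbb D\text{ with }E_{\mathcal D}(u,f,\lambda)^{1/2}\le(b\omega-C_2)\varepsilon_{i-1}.$$
   Context: **Problem.** $\Omega\subset\mathbb R^n$ is a domain, $V$, $F$ are real Hilbert spaces of functions on $\Omega$, $\bar\Lambda$ is a set of functions (parameters) on $\Omega$; for all $(f,\lambda)\in F\times\bar\Lambda$ the problem $A_\lambda u=f$ has a unique solution $u=u(f,\lambda)\in V$. $\Lambda\subseteq\bar\Lambda$ is the set of admissible parameters. **$h$-partitions.** An initial essentially disjoint partition of $\bar\Omega$ into finitely many closed element domains is given; each element domain $K$ can be split in a unique way into two children $K',K''$ with $K=K'\cup K''$, $|K'\cap K''|=0$. The set $\mathfrak K$ of all element domains so obtained is an infinite binary master tree. A finite subset is a subtree if it contains all roots and, for each element in it that is not a root, also its parent and sibling. The leaves of a subtree form an $h$-partition; $\mathbb K$ is the set of all $h$-partitions. $\mathcal K\le\tilde{\mathcal K}$ means that each $K\in\tilde{\mathcal K}$ is in $\mathcal K$ or has an ancestor in $\mathcal K$. **Local spaces.** For $K\in\mathfrak K$ there are spaces $V_K,F_K,\Lambda_K$ of functions on $K$ such that for each $\mathcal K\in\mathbb K$, $V\subseteq\prod_{K\in\mathcal K}V_K$, $F=\prod_{K\in\mathcal K}F_K$, $\Lambda\subseteq\prod_{K\in\mathcal K}\Lambda_K\subseteq\bar\Lambda$. For $(K,d)\in\mathfrak K\times\mathbb N$ ($\mathbb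 N$ = positive integers) and $Z\in\{V,F,\Lambda\}$ there are finite dimensional $Z_{K,d}\subset Z_K$ with $Z_{K,d}\subseteq Z_{K,d+1}$, $Z_{K,d}\subset Z_{K',d}\times Z_{K'',d}$, and $Z\cap\bigcup_{\mathcal K\in\mathbb K,d\in\mathbb N}\prod_{K\in\mathcal K}Z_{K,d}$ dense in $Z$. **$hp$-partitions.** An $hp$-element is a pair $D=(K_D,d_D)\in\mathfrak K\times\mathbb N$; $Z_D:=Z_{K_D,d_D}$. An $hp$-partition is a collection $\mathcal D$ of $hp$-elements with $\mathcal K(\mathcal D):=\{K_D:D\in\mathcal D\}\in\mathbb K$; $\mathbb D$ is the set of all of them; $\#\mathcal D:=\sum_{D\in\mathcal D}d_D$; $Z_{\mathcal D}:=\prod_{D\in\mathcal D}Z_D$; $V^c_{\mathcal D}:=V_{\mathcal D}\cap V$. $\mathcal D\le\tilde{\mathcal D}$ means $\mathcal K(\mathcal D)\le\mathcal K(\tilde{\mathcal D})$ and $d_{\tilde D}\ge d_D$ whenever $D\in\mathcal D$, $\tilde D\in\tilde{\mathcal D}$ and $K_D$ equals or is an ancestor of $K_{\tilde D}$. **Projectors and error functionals.** For each $hp$-element $D$ there are a projector $Q_D:V\times F\times\Lambda\to V_D\times F_D\times\Lambda_D$, $Q_D(v,f,\lambda)=(v_D,f_D,\lambda_D)$, where $(f_D,\lambda_D)$ depends only on $(f,\lambda)$, and a local error functional $e_D(v,f,\lambda)\ge0$ such that $e_{D'}+e_{D''}\le e_D$ if $K_{D'},K_{D''}$ are the children of $K_D$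 and $d_{D'}=d_{D''}=d_D$, and $e_{D'}\le e_D$ if $K_{D'}=K_D$ and $d_{D'}\ge d_D$. Set $E_{\mathcal D}(v,f,\lambda):=\sum_{D\in\mathcal D}e_D(v,f,\lambda)$, $f_{\mathcal D}:=\prod_{D\in\mathcal D}f_D$, $\lambda_{\mathcal D}:=\prod_{D\in\mathcal D}\lambda_D$. **Conforming partitions.** $\mathbb D^c\subseteq\mathbb D$ is a given subset and $\mathcal C:\mathbb D\to\mathbb D^c$ a mapping with $\mathcal C(\mathcal D)\ge\mathcal D$ for all $\mathcal D\in\mathbb D$. **Routines.** - $[\mathcal D,f_{\mathcal D},\lambda_{\mathcal D}]:=\mathbf{hp}\text{-}\mathbf{NEARBEST}(\varepsilon,v,f,\lambda)$: for $\varepsilon>0$, $(v,f,\lambda)\in V\times F\times\Lambda$ it outputs $\mathcal D\in\mathbb D$ and $(f_{\mathcal D},\lambda_{\mathcal D})$ such that $E_{\mathcal D}(v,f,\lambda)^{1/2}\le\varepsilon$ and $\#\mathcal D\le B\#\hat{\mathcal D}$ for any $\hat{\mathcal D}\in\mathbb D$ with $E_{\hat{\mathcal D}}(v,f,\lambda)^{1/2}\le b\varepsilon$, where $0<b\le1\le B$ are fixed constants. - $[\bar{\mathcal D},\bar u]:=\mathbf{PDE}(\varepsilon,\mathcal D^\circ,g,\kappa)$: for $\varepsilon>0$, $\mathcal D^\circ\in\mathbb D^c$ and piecewise discrete data $(g,\kappa)\in F_{\mathcal D^\circ}\times\Lambda_{\mathcal D^\circ}$ it outputs $\bar{\mathcal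 D}\in\mathbb D^c$ with $\mathcal D^\circ\le\bar{\mathcal D}$ and $\bar u\in V^c_{\bar{\mathcal D}}$ with $\|u(g,\kappa)-\bar u\|_V\le\varepsilon$. **Basic algorithm $\mathbf{hp}$-$\mathbf{AFEM}(\bar u_0,f,\lambda,\varepsilon_0)$.** For $i=1,2,\dots$: $[\mathcal D_i,f_{\mathcal D_i},\lambda_{\mathcal D_i}]:=\mathbf{hp}\text{-}\mathbf{NEARBEST}(\omega\varepsilon_{i-1},\bar u_{i-1},f,\lambda)$; $[\bar{\mathcal D}_i,\bar u_i]:=\mathbf{PDE}(\mu\varepsilon_{i-1},\mathcal C(\mathcal D_i),f_{\mathcal D_i},\lambda_{\mathcal D_i})$; $\varepsilon_i:=(\mu+C_1\omega)\varepsilon_{i-1}$. *)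

theory Defs
  imports "HOL-Analysis.Analysis"
begin

section \<open>Functions modulo equality almost everywhere\<close>

text \<open>Members of a product over an essentially disjoint partition are identified with
  piecewise defined functions. These have no well-defined values on the interfaces, so functions are
  taken modulo Lebesgue null sets.\<close>

quotient_type (overloaded) ('a, 'b) aefun =
  "'a::euclidean_space \<Rightarrow> 'b" / "\<lambda>f g. AE x in lebesgue. f x = g x"
proof (rule equivpI)
  show "reflp (\<lambda>f g :: 'a \<Rightarrow> 'b. AE x in lebesgue. f x = g x)"
    by (rule reflpI) simp
  show "symp (\<lambda>f g :: 'a \<Rightarrow> 'b. AE x in lebesgue. f x = g x)"
    by (rule sympI) (simp add: eq_commute)
  show "transp (\<lambda>f g :: 'a \<Rightarrow> 'b. AE x in lebesgue. f x = g x)"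
  proof (rule transpI)
    fix f g h :: "'a \<Rightarrow> 'b"
    assume "AE x in lebesgue. f x = g x" "AE x in lebesgue. g x = h x"
    then show "AE x in lebesgue. f x = h x" by eventually_elim simp
  qed
qed

instantiation aefun :: (euclidean_space, real_vector) real_vector
begin

lift_definition zero_aefun :: "('a, 'b) aefun" is "\<lambda>_. 0" .

lift_definition plus_aefun :: "('a, 'b) aefun \<Rightarrow> ('a, 'b) aefun \<Rightarrow> ('a, 'b) aefun"
  is "\<lambda>f g x. f x + g x"
proof -
  fix f f' g g' :: "'a \<Rightarrow> 'b"
  assume "AE x in lebesgue. f x = f' x" "AE x in lebesgue. g x = g' x"
  then show "AE x in lebesgue. f x + g x = f' x + g' x" by eventually_elim simp
qed

lift_definition minus_aefun :: "('a, 'b) aefun \<Rightarrow> ('a, 'b) aefun \<Rightarrow> ('a, 'b) aefun"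
  is "\<lambda>f g x. f x - g x"
proof -
  fix f f' g g' :: "'a \<Rightarrow> 'b"
  assume "AE x in lebesgue. f x = f' x" "AE x in lebesgue. g x = g' x"
  then show "AE x in lebesgue. f x - g x = f' x - g' x" by eventually_elim simp
qed

lift_definition uminus_aefun :: "('a, 'b) aefun \<Rightarrow> ('a, 'b) aefun"
  is "\<lambda>f x. - f x"
  by (erule eventually_mono) simp

lift_definition scaleR_aefun :: "real \<Rightarrow> ('a, 'b) aefun \<Rightarrow> ('a, 'b) aefun"
  is "\<lambda>c f x. c *\<^sub>R f x"
  by (erule eventually_mono) simp

instance
  by standard (transfer, simp add: algebra_simps)+

end

lift_definition restr :: "'a::euclidean_space set \<Rightarrow> ('a, 'b::real_vector) aefun \<Rightarrow> ('a, 'b) aefun"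
  is "\<lambda>S f x. if x \<in> S then f x else 0"
  by (erule eventually_mono) simp

text \<open>Functions on \<open>S\<close> are represented by their extension by zero.\<close>

definition functions_on :: "'a::euclidean_space set \<Rightarrow> ('a, 'b::real_vector) aefun set" where
  "functions_on S = {g. restr S g = g}"

text \<open>The product of spaces \<open>Z i\<close> of functions on essentially disjoint sets \<open>dm i\<close>, seen as a space
  of functions on the union.\<close>

definition pw_product ::
  "'i set \<Rightarrow> ('i \<Rightarrow> 'a::euclidean_space set) \<Rightarrow> ('i \<Rightarrow> ('a, 'b::real_vector) aefun set)
    \<Rightarrow> ('a, 'b) aefun set" where
  "pw_product I dm Z =
     {g \<in> functions_on (\<Union>i\<in>I. dm i). \<forall>i\<in>I. restr (dm i) g \<in> Z i}"

text \<open>The element \<open>(g i)\<close> of such a product is, with extension by zero, simply \<open>\<Sum>i\<in>I. g i\<close>.\<close>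

lemma restr_add: "restr S (f + g) = restr S f + restr S g"
  by transfer simp

lemma restr_zero [simp]: "restr S 0 = 0"
  by transfer simp

lemma restr_sum: "restr S (\<Sum>i\<in>I. g i) = (\<Sum>i\<in>I. restr S (g i))"
  by (induction I rule: infinite_finite_induct) (simp_all add: restr_add)

lemma restr_restr: "restr S (restr T g) = restr (S \<inter> T) g"
  by transfer simp

lemma restr_negligible:
  fixes g :: "('a::euclidean_space, 'b::real_vector) aefun"
  assumes "negligible S"
  shows "restr S g = 0"
proof -
  have "AE x in lebesgue. x \<notin> S"
    using assms by (simp add: negligible_iff_null_sets AE_not_in)
  then have "AE x in lebesgue. (if x \<in> S then h x else 0) = 0" for h :: "'a \<Rightarrow> 'b"
    by eventually_elim simp
  then show ?thesis by transfer
qed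

lemma restr_sum_disjoint:
  assumes "finite I" "j \<in> I" and g: "\<And>i. i \<in> I \<Longrightarrow> g i \<in> functions_on (dm i)"
    and "\<And>i. i \<in> I \<Longrightarrow> i \<noteq> j \<Longrightarrow> negligible (dm j \<inter> dm i)"
  shows "restr (dm j) (\<Sum>i\<in>I. g i) = g j"
proof -
  have "restr (dm j) (g i) = (if i = j then g j else 0)" if "i \<in> I" for i
  proof (cases "i = j")
    case False
    have "restr (dm j) (g i) = restr (dm j \<inter> dm i) (g i)"
      using g[OF that] restr_restr[of "dm j" "dm i" "g i"] by (simp add: functions_on_def)
    then show ?thesis using assms(4)[OF that False] False by (simp add: restr_negligible)
  qed (use g[OF that] in \<open>simp add: functions_on_def\<close>)
  then show ?thesis
    using assms(1,2) by (simp add: restr_sum)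
qed


section \<open>Hilbert spaces of functions\<close>

definition hnorm :: "('v \<Rightarrow> 'v \<Rightarrow> real) \<Rightarrow> 'v \<Rightarrow> real" where
  "hnorm ip x = sqrt (ip x x)"

definition hilbert_on :: "'v::real_vector set \<Rightarrow> ('v \<Rightarrow> 'v \<Rightarrow> real) \<Rightarrow> bool" where
  "hilbert_on H ip \<longleftrightarrow>
     subspace H \<and>
     (\<forall>x\<in>H. \<forall>y\<in>H. ip x y = ip y x) \<and>
     (\<forall>x\<in>H. \<forall>y\<in>H. \<forall>z\<in>H. ip (x + y) z = ip x z + ip y z) \<and>
     (\<forall>c. \<forall>x\<in>H. \<forall>y\<in>H. ip (c *\<^sub>R x) y = c * ip x y) \<and>
     (\<forall>x\<in>H. x \<noteq> 0 \<longrightarrow> 0 < ip x x) \<and>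
     (\<forall>s. (\<forall>n::nat. s n \<in> H) \<and>
          (\<forall>\<epsilon>>0. \<exists>N. \<forall>m\<ge>N. \<forall>n\<ge>N. hnorm ip (s m - s n) < \<epsilon>) \<longrightarrow>
          (\<exists>l\<in>H. (\<lambda>n. hnorm ip (s n - l)) \<longlonglongrightarrow> 0))"

definition hdense :: "('v::real_vector \<Rightarrow> 'v \<Rightarrow> real) \<Rightarrow> 'v set \<Rightarrow> 'v set \<Rightarrow> bool" where
  "hdense ip H S \<longleftrightarrow> S \<subseteq> H \<and> (\<forall>x\<in>H. \<forall>\<epsilon>>0. \<exists>s\<in>S. hnorm ip (x - s) < \<epsilon>)"


section \<open>The data of the abstract hp-framework\<close>

type_synonym 'a hp_element = "'a set \<times> nat"

text \<open>\<open>'v\<close>, \<open>'f\<close>, \<open>'l\<close> are the types of values of solutions, right-hand sides and parameters.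
  The operators \<open>opA \<lambda>\<close> take values in \<open>'y\<close> (for instance a dual space), into which the right-hand
  sides are embedded by \<open>embF\<close>. The field \<open>topLam\<close> is the topology in which density in \<open>\<Lambda>\<close>
  is understood.\<close>

record (overloaded) ('a, 'v, 'f, 'l, 'y) hp_data =
  Om :: "'a::euclidean_space set"
  spV :: "('a, 'v::real_vector) aefun set"
  ipV :: "('a, 'v) aefun \<Rightarrow> ('a, 'v) aefun \<Rightarrow> real"
  spF :: "('a, 'f::real_vector) aefun set"
  ipF :: "('a, 'f) aefun \<Rightarrow> ('a, 'f) aefun \<Rightarrow> real"
  LamBar :: "('a, 'l::real_vector) aefun set"
  Lam :: "('a, 'l) aefun set"
  topLam :: "('a, 'l) aefun topology"
  opA :: "('a, 'l) aefun \<Rightarrow> ('a, 'v) aefun \<Rightarrow> 'y"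
  embF :: "('a, 'f) aefun \<Rightarrow> 'y"
  roots :: "'a set set"
  child1 :: "'a set \<Rightarrow> 'a set"
  child2 :: "'a set \<Rightarrow> 'a set"
  locV :: "'a set \<Rightarrow> ('a, 'v) aefun set"
  locF :: "'a set \<Rightarrow> ('a, 'f) aefun set"
  locL :: "'a set \<Rightarrow> ('a, 'l) aefun set"
  discV :: "'a hp_element \<Rightarrow> ('a, 'v) aefun set"
  discF :: "'a hp_element \<Rightarrow> ('a, 'f) aefun set"
  discL :: "'a hp_element \<Rightarrow> ('a, 'l) aefun set"
  projQ :: "'a hp_element \<Rightarrow> ('a, 'v) aefun \<times> ('a, 'f) aefun \<times> ('a, 'l) aefun
              \<Rightarrow> ('a, 'v) aefun \<times> ('a, 'f) aefun \<times> ('a, 'l) aefun"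
  locerr :: "'a hp_element \<Rightarrow> ('a, 'v) aefun \<times> ('a, 'f) aefun \<times> ('a, 'l) aefun \<Rightarrow> real"
  confD :: "'a hp_element set set"
  confmap :: "'a hp_element set \<Rightarrow> 'a hp_element set"

definition normV where "normV S v = hnorm (ipV S) v"

definition sol where
  "sol S f l = (THE v. v \<in> spV S \<and> opA S l v = embF S f)"

subsection \<open>h-partitions\<close>

definition domain :: "'a::euclidean_space set \<Rightarrow> bool" where
  "domain U \<longleftrightarrow> open U \<and> connected U \<and> U \<noteq> {}"

definition closed_domain :: "'a::euclidean_space set \<Rightarrow> bool" where
  "closed_domain K \<longleftrightarrow> (\<exists>U. domain U \<and> K = closure U)"

inductive_set master_tree for S where
  root: "K \<in> roots S \<Longrightarrow> K \<in> master_tree S"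
| child1: "K \<in> master_tree S \<Longrightarrow> child1 S K \<in> master_tree S"
| child2: "K \<in> master_tree S \<Longrightarrow> child2 S K \<in> master_tree S"

definition parent_rel where
  "parent_rel S = {(P, K). P \<in> master_tree S \<and> K \<in> {child1 S P, child2 S P}}"

definition ancestor where
  "ancestor S P K \<longleftrightarrow> (P, K) \<in> (parent_rel S)\<^sup>+"

text \<open>Only non-roots have a parent; the parent and both its children (the element and its sibling)
  must belong to a subtree.\<close>

definition is_subtree where
  "is_subtree S T \<longleftrightarrow>
     finite T \<and> T \<subseteq> master_tree S \<and> roots S \<subseteq> T \<and>
     (\<forall>K\<in>T. \<forall>P. (P, K) \<in> parent_rel S \<longrightarrow> P \<in> T \<and> child1 S P \<in> T \<and> child2 S P \<in> T)"

definition leaves where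
  "leaves S T = {K \<in> T. child1 S K \<notin> T \<and> child2 S K \<notin> T}"

definition h_partitions where
  "h_partitions S = {leaves S T |T. is_subtree S T}"

definition h_le where
  "h_le S \<K> \<K>' \<longleftrightarrow> (\<forall>K\<in>\<K>'. K \<in> \<K> \<or> (\<exists>P\<in>\<K>. ancestor S P K))"

subsection \<open>hp-partitions\<close>

text \<open>An hp-element is a pair of an element domain and a positive local dimension.
  Injectivity of \<open>fst\<close>: each element domain of the partition carries exactly one local dimension.\<close>

definition hp_partitions where
  "hp_partitions S =
     {\<D>. (\<forall>D\<in>\<D>. fst D \<in> master_tree S \<and> 1 \<le> snd D) \<and> inj_on fst \<D> \<and> fst ` \<D> \<in> h_partitions S}"

definition hp_card :: "'a hp_element set \<Rightarrow> nat" where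
  "hp_card \<D> = (\<Sum>D\<in>\<D>. snd D)"

definition hp_le where
  "hp_le S \<D> \<D>' \<longleftrightarrow>
     h_le S (fst ` \<D>) (fst ` \<D>') \<and>
     (\<forall>D\<in>\<D>. \<forall>D'\<in>\<D>'. fst D = fst D' \<or> ancestor S (fst D) (fst D') \<longrightarrow> snd D \<le> snd D')"

text \<open>The global spaces \<open>Z\<^sub>\<D>\<close>, for \<open>Z\<close> one of \<open>discV S\<close>, \<open>discF S\<close>, \<open>discL S\<close>.\<close>

definition glob :: "('a hp_element \<Rightarrow> ('a, 'b) aefun set) \<Rightarrow> 'a hp_element set
    \<Rightarrow> ('a::euclidean_space, 'b::real_vector) aefun set" where
  "glob Z \<D> = pw_product \<D> fst Z"

definition confV where
  "confV S \<D> = glob (discV S) \<D> \<inter> spV S"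

definition Err where
  "Err S \<D> v f l = (\<Sum>D\<in>\<D>. locerr S D (v, f, l))"

text \<open>\<open>f\<^sub>D\<close> and \<open>\<lambda>\<^sub>D\<close> do not depend on the first argument of the projector, for which \<open>0\<close> is used.
  With extension by zero, \<open>\<Prod>\<^sub>D f\<^sub>D\<close> is a sum.\<close>

definition dataF where
  "dataF S \<D> f l = (\<Sum>D\<in>\<D>. fst (snd (projQ S D (0, f, l))))"

definition dataL where
  "dataL S \<D> f l = (\<Sum>D\<in>\<D>. snd (snd (projQ S D (0, f, l))))"


section \<open>The standing assumptions\<close>

definition local_spaces where
  "local_spaces S ZK ZD \<longleftrightarrow> (\<forall>K\<in>master_tree S.
     ZK K \<subseteq> functions_on K \<and>
     (\<forall>d\<ge>1. ZD (K, d) \<subseteq> ZK K \<and>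
        (\<exists>X. finite X \<and> ZD (K, d) \<subseteq> span X) \<and>
        ZD (K, d) \<subseteq> ZD (K, d + 1) \<and>
        ZD (K, d) \<subseteq> pw_product {child1 S K, child2 S K} (\<lambda>K'. K') (\<lambda>K'. ZD (K', d))))"

definition discrete_functions where
  "discrete_functions S ZD =
     (\<Union>\<K>\<in>h_partitions S. \<Union>d\<in>{1..}. pw_product \<K> (\<lambda>K. K) (\<lambda>K. ZD (K, d)))"

text \<open>The sets \<open>locL\<close> and \<open>discL\<close> need not be linear, since sets of parameters usually are not
  (positivity of coefficients); finite dimensionality of \<open>discL\<close> then refers to the span.\<close>

locale hp_framework =
  fixes S :: "('a::euclidean_space, 'v::real_vector, 'f::real_vector, 'l::real_vector, 'y) hp_data"
  assumes domain_Om: "domain (Om S)"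
    and V_functions: "spV S \<subseteq> functions_on (Om S)"
    and V_hilbert: "hilbert_on (spV S) (ipV S)"
    and F_functions: "spF S \<subseteq> functions_on (Om S)"
    and F_hilbert: "hilbert_on (spF S) (ipF S)"
    and LamBar_functions: "LamBar S \<subseteq> functions_on (Om S)"
    and Lam_subset: "Lam S \<subseteq> LamBar S"
    and topspace_topLam: "topspace (topLam S) = Lam S"
    and embF_inj: "inj_on (embF S) (spF S)"
    and unique_solution:
      "\<And>f l. f \<in> spF S \<Longrightarrow> l \<in> LamBar S \<Longrightarrow> \<exists>!v. v \<in> spV S \<and> opA S l v = embF S f"
    and finite_roots: "finite (roots S)"
    and roots_cover: "\<Union>(roots S) = closure (Om S)"
    and roots_disjoint: "pairwise (\<lambda>K K'. negligible (K \<inter> K')) (roots S)"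
    and element_domain: "\<And>K. K \<in> master_tree S \<Longrightarrow> closed_domain K"
    and children: "\<And>K. K \<in> master_tree S \<Longrightarrow>
      K = child1 S K \<union> child2 S K \<and> negligible (child1 S K \<inter> child2 S K)"
    and V_product: "\<And>\<K>. \<K> \<in> h_partitions S \<Longrightarrow> spV S \<subseteq> pw_product \<K> (\<lambda>K. K) (locV S)"
    and F_product: "\<And>\<K>. \<K> \<in> h_partitions S \<Longrightarrow> spF S = pw_product \<K> (\<lambda>K. K) (locF S)"
    and Lam_product: "\<And>\<K>. \<K> \<in> h_partitions S \<Longrightarrow>
      Lam S \<subseteq> pw_product \<K> (\<lambda>K. K) (locL S) \<and> pw_product \<K> (\<lambda>K. K) (locL S) \<subseteq> LamBar S"
    and local_V: "local_spaces S (locV S) (discV S)"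
    and local_F: "local_spaces S (locF S) (discF S)"
    and local_L: "local_spaces S (locL S) (discL S)"
    and subspace_loc: "\<And>K. K \<in> master_tree S \<Longrightarrow> subspace (locV S K) \<and> subspace (locF S K)"
    and subspace_disc: "\<And>K d. K \<in> master_tree S \<Longrightarrow> 1 \<le> d \<Longrightarrow>
      subspace (discV S (K, d)) \<and> subspace (discF S (K, d))"
    and dense_V: "hdense (ipV S) (spV S) (spV S \<inter> discrete_functions S (discV S))"
    and dense_F: "hdense (ipF S) (spF S) (spF S \<inter> discrete_functions S (discF S))"
    and dense_L: "topLam S closure_of (Lam S \<inter> discrete_functions S (discL S)) = Lam S"
    \<comment> \<open>idempotence of \<open>Q\<^sub>D\<close> is stated for those values of \<open>Q\<^sub>D\<close> to which \<open>Q\<^sub>D\<close> can be applied,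
        i.e. which are restrictions to \<open>K\<^sub>D\<close> of members of \<open>V \<times> F \<times> \<Lambda>\<close>\<close>
    and proj_range: "\<And>K d x. K \<in> master_tree S \<Longrightarrow> 1 \<le> d \<Longrightarrow> x \<in> spV S \<times> spF S \<times> Lam S \<Longrightarrow>
      projQ S (K, d) x \<in> discV S (K, d) \<times> discF S (K, d) \<times> discL S (K, d)"
    and proj_idem: "\<And>K d x v f l. K \<in> master_tree S \<Longrightarrow> 1 \<le> d \<Longrightarrow>
      x \<in> spV S \<times> spF S \<times> Lam S \<Longrightarrow> (v, f, l) \<in> spV S \<times> spF S \<times> Lam S \<Longrightarrow>
      projQ S (K, d) x = (restr K v, restr K f, restr K l) \<Longrightarrow>
      projQ S (K, d) (v, f, l) = projQ S (K, d) x"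
    and proj_data: "\<And>K d v v' f l. K \<in> master_tree S \<Longrightarrow> 1 \<le> d \<Longrightarrow>
      v \<in> spV S \<Longrightarrow> v' \<in> spV S \<Longrightarrow> f \<in> spF S \<Longrightarrow> l \<in> Lam S \<Longrightarrow>
      snd (projQ S (K, d) (v, f, l)) = snd (projQ S (K, d) (v', f, l))"
    and err_nonneg: "\<And>K d x. K \<in> master_tree S \<Longrightarrow> 1 \<le> d \<Longrightarrow> x \<in> spV S \<times> spF S \<times> Lam S \<Longrightarrow>
      0 \<le> locerr S (K, d) x"
    and err_split: "\<And>K d x. K \<in> master_tree S \<Longrightarrow> 1 \<le> d \<Longrightarrow> x \<in> spV S \<times> spF S \<times> Lam S \<Longrightarrow>
      locerr S (child1 S K, d) x + locerr S (child2 S K, d) x \<le> locerr S (K, d) x"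
    and err_mono: "\<And>K d d' x. K \<in> master_tree S \<Longrightarrow> 1 \<le> d \<Longrightarrow> d \<le> d' \<Longrightarrow>
      x \<in> spV S \<times> spF S \<times> Lam S \<Longrightarrow> locerr S (K, d') x \<le> locerr S (K, d) x"
    and confD_subset: "confD S \<subseteq> hp_partitions S"
    and confmap: "\<And>\<D>. \<D> \<in> hp_partitions S \<Longrightarrow> confmap S \<D> \<in> confD S \<and> hp_le S \<D> (confmap S \<D>)"


section \<open>The routines and the basic algorithm\<close>

definition is_hp_NEARBEST where
  "is_hp_NEARBEST S b B NB \<longleftrightarrow>
     (\<forall>\<epsilon>>0. \<forall>v\<in>spV S. \<forall>f\<in>spF S. \<forall>l\<in>Lam S. \<exists>\<D>\<in>hp_partitions S.
        NB \<epsilon> v f l = (\<D>, dataF S \<D> f l, dataL S \<D> f l) \<and>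
        sqrt (Err S \<D> v f l) \<le> \<epsilon> \<and>
        (\<forall>\<D>'\<in>hp_partitions S. sqrt (Err S \<D>' v f l) \<le> b * \<epsilon> \<longrightarrow>
           real (hp_card \<D>) \<le> B * real (hp_card \<D>')))"

definition is_PDE where
  "is_PDE S PDE \<longleftrightarrow>
     (\<forall>\<epsilon>>0. \<forall>\<D>\<in>confD S. \<forall>g\<in>glob (discF S) \<D>. \<forall>k\<in>glob (discL S) \<D>.
        \<exists>\<D>'\<in>confD S. \<exists>w\<in>confV S \<D>'.
          PDE \<epsilon> \<D> g k = (\<D>', w) \<and> hp_le S \<D> \<D>' \<and> normV S (sol S g k - w) \<le> \<epsilon>)"

text \<open>The sequences produced by the algorithm; the values at index \<open>0\<close> of \<open>Ds\<close> and \<open>Dbar\<close> are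
  irrelevant.\<close>

definition hp_AFEM where
  "hp_AFEM S NB PDE C1 \<mu> \<omega> ubar0 f l \<epsilon>0 Ds Dbar ubar \<epsilon> \<longleftrightarrow>
     ubar 0 = ubar0 \<and> \<epsilon> 0 = \<epsilon>0 \<and>
     (\<forall>i\<ge>1::nat. \<exists>fD lD.
        (Ds i, fD, lD) = NB (\<omega> * \<epsilon> (i - 1)) (ubar (i - 1)) f l \<and>
        (Dbar i, ubar i) = PDE (\<mu> * \<epsilon> (i - 1)) (confmap S (Ds i)) fD lD \<and>
        \<epsilon> i = (\<mu> + C1 * \<omega>) * \<epsilon> (i - 1))"

end

theory Submission
  imports Defs
begin

text \<open>The error bound is an invariant of the loop. Suppose that \<open>\<parallel>u - ubar (i - 1)\<parallel> \<le> \<epsilon> (i - 1)\<close>.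
  The near-best routine makes the error functional at \<open>ubar (i - 1)\<close> at most \<open>\<omega> \<epsilon> (i - 1)\<close>; this
  number bounds the infimum over all \<open>w\<close>, so replacing the data by their projections moves the exact
  solution by at most \<open>C1 \<omega> \<epsilon> (i - 1)\<close>. The solver adds at most \<open>\<mu> \<epsilon> (i - 1)\<close>, and the triangle
  inequality in \<open>V\<close> (\<open>hilbert_on_triangle\<close>) gives \<open>\<parallel>u - ubar i\<parallel> \<le> (\<mu> + C1 \<omega>) \<epsilon> (i - 1) = \<epsilon> i\<close>.
  Given the invariant, the statements about \<open>D i\<close> only transfer the guarantees of the near-best
  routine from \<open>ubar (i - 1)\<close> to \<open>u\<close>: by the Lipschitz condition this costs \<open>C2 \<epsilon> (i - 1)\<close>, which is
  added to the tolerance \<open>\<omega> \<epsilon> (i - 1)\<close> that is met, and subtracted from the tolerance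
  \<open>b \<omega> \<epsilon> (i - 1)\<close> that competing partitions may use.

  What this argument takes for granted is that the solver may be called at all: the projected data,
  which are discrete on \<open>D i\<close>, must be discrete on the finer conforming partition, and they must lie
  in \<open>F\<close> and in the set of parameters for which the problem is uniquely solvable. The second
  requirement follows from the first, since \<open>F\<close> and the set of parameters contain all products of
  local spaces. The first one is \<open>glob_sum_refine\<close>. It holds because the leaves of a subtree are essentially disjoint
  (\<open>leaves_disjoint\<close>), so that the restriction of the glued function to an element is its local
  piece, because discrete spaces are passed on to descendants (\<open>local_spaces_descendant\<close>), and
  because the leaves of every subtree cover the whole domain (\<open>Union_leaves\<close>).\<close>

section \<open>The triangle inequality\<close>

lemma hilbert_on_triangle:
  assumes H: "hilbert_on H ip" and x: "x \<in> H" and y: "y \<in> H"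
  shows "hnorm ip (x + y) \<le> hnorm ip x + hnorm ip y"
proof -
  have sub: "subspace H"
    and sym: "\<And>x y. x \<in> H \<Longrightarrow> y \<in> H \<Longrightarrow> ip x y = ip y x"
    and add: "\<And>x y z. x \<in> H \<Longrightarrow> y \<in> H \<Longrightarrow> z \<in> H \<Longrightarrow> ip (x + y) z = ip x z + ip y z"
    and scale: "\<And>c x y. x \<in> H \<Longrightarrow> y \<in> H \<Longrightarrow> ip (c *\<^sub>R x) y = c * ip x y"
    and pos: "\<And>x. x \<in> H \<Longrightarrow> x \<noteq> 0 \<Longrightarrow> 0 < ip x x"
    using H unfolding hilbert_on_def by blast+
  have zero: "ip 0 z = 0" if "z \<in> H" for z
    using scale[of z z 0] that by simp
  have nonneg: "0 \<le> ip z z" if "z \<in> H" for z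
    using pos[OF that] zero[OF that] by (cases "z = 0") auto
  have expand: "ip (v + w) (v + w) = ip v v + 2 * ip v w + ip w w" if "v \<in> H" "w \<in> H" for v w
  proof -
    have vw: "v + w \<in> H" using that sub by (simp add: subspace_add)
    have "ip v (v + w) = ip v v + ip v w" "ip w (v + w) = ip v w + ip w w"
      using that vw add sym by metis+
    then show ?thesis using add[OF that vw] by simp
  qed
  have CS: "ip x y \<le> sqrt (ip x x) * sqrt (ip y y)"
  proof (cases "y = 0")
    case True
    then show ?thesis using zero[OF x] sym[OF x y] zero[OF y] by simp
  next
    case False
    define p q c where "p = ip x y" and "q = ip y y" and "c = - p / q"
    have q: "0 < q" using pos[OF y False] by (simp add: q_def)
    have cy: "c *\<^sub>R y \<in> H" using sub y by (simp add: subspace_scale)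
    have "ip x (c *\<^sub>R y) = c * p" "ip (c *\<^sub>R y) (c *\<^sub>R y) = c * (c * q)"
      using scale sym x y cy by (metis p_def, metis q_def)
    then have "0 \<le> ip x x + 2 * (c * p) + c * (c * q)"
      using nonneg[OF subspace_add[OF sub x cy]] expand[OF x cy] by simp
    also have "\<dots> = ip x x - p\<^sup>2 / q"
      using q by (simp add: c_def field_simps power2_eq_square)
    finally have "p\<^sup>2 \<le> ip x x * q" using q by (simp add: field_simps)
    then have "p \<le> sqrt (ip x x * q)" by (rule real_le_rsqrt)
    then show ?thesis by (simp add: p_def q_def real_sqrt_mult)
  qed
  have "ip (x + y) (x + y) \<le> (sqrt (ip x x) + sqrt (ip y y))\<^sup>2"
    using expand[OF x y] CS nonneg[OF x] nonneg[OF y] by (simp add: power2_sum)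
  then show ?thesis
    unfolding hnorm_def by (intro real_le_lsqrt) (simp_all add: nonneg x y)
qed

section \<open>Piecewise products\<close>

lemma functions_on_mono: "A \<subseteq> B \<Longrightarrow> g \<in> functions_on A \<Longrightarrow> g \<in> functions_on B"
  by (metis (mono_tags, lifting) functions_on_def inf.absorb2 mem_Collect_eq restr_restr)

lemma functions_on_sum:
  "(\<And>i. i \<in> I \<Longrightarrow> g i \<in> functions_on A) \<Longrightarrow> (\<Sum>i\<in>I. g i) \<in> functions_on A"
  by (simp add: functions_on_def restr_sum)

lemma glob_subset_pw_product:
  assumes "\<And>D. D \<in> \<D> \<Longrightarrow> Z D \<subseteq> Y (fst D)"
  shows "glob Z \<D> \<subseteq> pw_product (fst ` \<D>) (\<lambda>K. K) Y"
  using assms by (force simp: glob_def pw_product_def)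

section \<open>The geometry of the master tree\<close>

lemma closed_domain_not_negligible: "closed_domain K \<Longrightarrow> \<not> negligible K"
  unfolding closed_domain_def domain_def
  by (metis closure_subset negligible_subset open_not_negligible)

lemma hp_partitions_h_partition: "\<D> \<in> hp_partitions S \<Longrightarrow> fst ` \<D> \<in> h_partitions S"
  by (simp add: hp_partitions_def)

lemma hp_partitionsD:
  assumes "\<D> \<in> hp_partitions S"
  shows "\<And>D. D \<in> \<D> \<Longrightarrow> fst D \<in> master_tree S" "\<And>D. D \<in> \<D> \<Longrightarrow> 1 \<le> snd D" "inj_on fst \<D>"
  using assms by (auto simp: hp_partitions_def)

lemma finite_hp_partition:
  assumes "\<D> \<in> hp_partitions S"
  shows "finite \<D>"
proof -
  have "finite (fst ` \<D>)"
    using hp_partitions_h_partition[OF assms]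
    by (auto simp: h_partitions_def is_subtree_def leaves_def)
  then show ?thesis using hp_partitionsD(3)[OF assms] finite_imageD by blast
qed

context hp_framework
begin

lemma child_subset:
  assumes "(P, K) \<in> parent_rel S"
  shows "K \<subseteq> P"
  using assms children by (auto simp: parent_rel_def)

lemma descendant_subset:
  assumes "(P, K) \<in> (parent_rel S)\<^sup>*"
  shows "K \<subseteq> P"
  using assms by induction (use child_subset in blast)+

text \<open>If one child were the whole element, its sibling would be contained in the null set in which
  they meet, although closed domains have positive measure.\<close>

lemma child_psubset:
  assumes "(P, K) \<in> parent_rel S"
  shows "K \<subset> P"
proof -
  have P: "P \<in> master_tree S" and K: "K = child1 S P \<or> K = child2 S P"
    using assms by (auto simp: parent_rel_def)
  have "\<not> negligible (child1 S P)" "\<not> negligible (child2 S P)"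
    using P by (simp_all add: closed_domain_not_negligible element_domain master_tree.child1
        master_tree.child2)
  moreover have "negligible (child1 S P \<inter> child2 S P)" using children[OF P] by blast
  ultimately have "\<not> child1 S P \<subseteq> child2 S P" "\<not> child2 S P \<subseteq> child1 S P"
    by (auto simp: Int_absorb1 Int_absorb2)
  then show ?thesis using children[OF P] K by blast
qed

text \<open>An element which is not a descendant of a given root lies in another root, and distinct roots
  meet in a null set.\<close>

lemma root_nested_or_disjoint:
  assumes R: "R \<in> roots S" and "L \<in> master_tree S"
  shows "negligible (R \<inter> L) \<or> (R, L) \<in> (parent_rel S)\<^sup>*"
proof -
  have step: "negligible (R \<inter> L) \<or> (R, L) \<in> (parent_rel S)\<^sup>*"
    if "(M, L) \<in> parent_rel S" "negligible (R \<inter> M) \<or> (R, M) \<in> (parent_rel S)\<^sup>*" for M L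
  proof -
    have "R \<inter> L \<subseteq> R \<inter> M" using child_subset[OF that(1)] by blast
    then show ?thesis using that by (meson negligible_subset rtrancl.rtrancl_into_rtrancl)
  qed
  from assms(2) show ?thesis
  proof induction
    case (root K)
    then show ?case using R roots_disjoint by (auto simp: pairwise_def)
  next
    case (child1 K)
    then show ?case using step[of K "child1 S K"] by (simp add: parent_rel_def)
  next
    case (child2 K)
    then show ?case using step[of K "child2 S K"] by (simp add: parent_rel_def)
  qed
qed

text \<open>The tree order is visible from the sets alone: two elements that are not related have branched
  off at a root or at a common ancestor, and the two branches meet in a null set.\<close>

lemma nested_or_disjoint:
  assumes "K \<in> master_tree S" and L: "L \<in> master_tree S"
  shows "negligible (K \<inter> L) \<or> (K, L) \<in> (parent_rel S)\<^sup>* \<or> (L, K) \<in> (parent_rel S)\<^sup>*"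
proof -
  have step: "negligible (K \<inter> L) \<or> (K, L) \<in> (parent_rel S)\<^sup>* \<or> (L, K) \<in> (parent_rel S)\<^sup>*"
    if NK: "(N, K) \<in> parent_rel S"
      and IH: "negligible (N \<inter> L) \<or> (N, L) \<in> (parent_rel S)\<^sup>* \<or> (L, N) \<in> (parent_rel S)\<^sup>*"
    for N K
    using IH
  proof (elim disjE)
    assume "negligible (N \<inter> L)"
    moreover have "K \<inter> L \<subseteq> N \<inter> L" using child_subset[OF NK] by blast
    ultimately show ?thesis using negligible_subset by blast
  next
    assume "(L, N) \<in> (parent_rel S)\<^sup>*"
    then show ?thesis using NK by (meson rtrancl.rtrancl_into_rtrancl)
  next
    assume "(N, L) \<in> (parent_rel S)\<^sup>*"
    then show ?thesis
    proof (cases rule: converse_rtranclE)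
      case base
      then show ?thesis using NK by blast
    next
      case (step M)
      show ?thesis
      proof (cases "M = K")
        case False
        \<comment> \<open>the path to \<open>L\<close> leaves \<open>N\<close> through the sibling \<open>M\<close> of \<open>K\<close>\<close>
        have "N \<in> master_tree S" "K \<inter> M = child1 S N \<inter> child2 S N"
          using NK step(1) False by (auto simp: parent_rel_def)
        then have "negligible (K \<inter> M)" using children by metis
        moreover have "K \<inter> L \<subseteq> K \<inter> M" using descendant_subset[OF step(2)] by blast
        ultimately show ?thesis using negligible_subset by blast
      qed (use step in blast)
    qed
  qed
  from assms(1) show ?thesis
  proof induction
    case (root K)
    then show ?case using root_nested_or_disjoint[OF _ L] by blast
  next
    case (child1 K)
    then show ?case using step[of K "child1 S K"] by (simp add: parent_rel_def)
  next
    case (child2 K)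
    then show ?case using step[of K "child2 S K"] by (simp add: parent_rel_def)
  qed
qed

lemma subtree_ancestor_closed:
  assumes "is_subtree S T" and "(K, L) \<in> (parent_rel S)\<^sup>*" and "L \<in> T"
  shows "K \<in> T"
  using assms(2,3)
  by (induction rule: converse_rtrancl_induct) (use assms(1) in \<open>auto simp: is_subtree_def\<close>)

text \<open>A leaf cannot be a proper ancestor of another leaf, since a subtree that contains an element
  contains the whole path leading to it.\<close>

lemma leaves_disjoint:
  assumes T: "is_subtree S T" and K: "K \<in> leaves S T" and L: "L \<in> leaves S T" and "K \<noteq> L"
  shows "negligible (K \<inter> L)"
proof -
  have no_path: "(K, L) \<notin> (parent_rel S)\<^sup>*"
    if K: "K \<in> leaves S T" and L: "L \<in> leaves S T" and "K \<noteq> L" for K L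
  proof
    assume "(K, L) \<in> (parent_rel S)\<^sup>*"
    then obtain M where M: "(K, M) \<in> parent_rel S" "(M, L) \<in> (parent_rel S)\<^sup>*"
      using \<open>K \<noteq> L\<close> by (meson converse_rtranclE)
    have "M \<in> T" using subtree_ancestor_closed[OF T M(2)] L by (simp add: leaves_def)
    then show False using M(1) K by (auto simp: parent_rel_def leaves_def)
  qed
  have "K \<in> master_tree S" "L \<in> master_tree S"
    using K L T by (auto simp: leaves_def is_subtree_def)
  then show ?thesis using nested_or_disjoint no_path K L \<open>K \<noteq> L\<close> by metis
qed

lemma master_tree_subset_roots:
  assumes "K \<in> master_tree S"
  shows "K \<subseteq> \<Union>(roots S)"
  using assms by induction (use children in blast)+

text \<open>Among the finitely many elements of a subtree that contain a given point, a smallest one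
  cannot be split within the subtree: the point would lie in one of its children.\<close>

lemma Union_leaves:
  assumes T: "is_subtree S T"
  shows "\<Union>(leaves S T) = closure (Om S)"
proof
  show "\<Union>(leaves S T) \<subseteq> closure (Om S)"
    using T master_tree_subset_roots roots_cover
    by (fastforce simp: leaves_def is_subtree_def)
next
  show "closure (Om S) \<subseteq> \<Union>(leaves S T)"
  proof
    fix x assume "x \<in> closure (Om S)"
    then obtain R where R: "R \<in> roots S" "x \<in> R" using roots_cover by blast
    define A where "A = {L \<in> T. x \<in> L}"
    have "finite A" "A \<noteq> {}"
      using T R by (auto simp: A_def is_subtree_def)
    then obtain L where L: "L \<in> A" and min: "\<And>M. M \<in> A \<Longrightarrow> M \<subseteq> L \<Longrightarrow> M = L"
      by (metis finite_has_minimal)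
    have LT: "L \<in> T" "x \<in> L" "L \<in> master_tree S"
      using L T by (auto simp: A_def is_subtree_def)
    have par: "(L, child1 S L) \<in> parent_rel S" "(L, child2 S L) \<in> parent_rel S"
      using LT by (auto simp: parent_rel_def)
    have "L \<in> leaves S T"
    proof (rule ccontr)
      assume "L \<notin> leaves S T"
      then have "child1 S L \<in> T \<or> child2 S L \<in> T" using LT by (simp add: leaves_def)
      then have "child1 S L \<in> T" "child2 S L \<in> T"
        using T par unfolding is_subtree_def by blast+
      moreover have "x \<in> child1 S L \<or> x \<in> child2 S L" using children[OF LT(3)] LT(2) by blast
      ultimately obtain M where "M \<in> A" "(L, M) \<in> parent_rel S" using par by (auto simp: A_def)
      then show False using child_psubset min by blast
    qed
    then show "x \<in> \<Union>(leaves S T)" using LT by blast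
  qed
qed

lemma Union_hp_partition:
  assumes "\<D> \<in> hp_partitions S"
  shows "(\<Union>D\<in>\<D>. fst D) = closure (Om S)"
proof -
  obtain T where "is_subtree S T" "fst ` \<D> = leaves S T"
    using hp_partitions_h_partition[OF assms] by (auto simp: h_partitions_def)
  then show ?thesis using Union_leaves by metis
qed

lemma hp_partition_disjoint:
  assumes "\<D> \<in> hp_partitions S" "D \<in> \<D>" "D' \<in> \<D>" "D \<noteq> D'"
  shows "negligible (fst D \<inter> fst D')"
proof -
  obtain T where T: "is_subtree S T" "fst ` \<D> = leaves S T"
    using hp_partitions_h_partition[OF assms(1)] by (auto simp: h_partitions_def)
  then have "fst D \<in> leaves S T" "fst D' \<in> leaves S T" using assms(2,3) by (metis imageI)+
  moreover have "fst D \<noteq> fst D'" using hp_partitionsD(3)[OF assms(1)] assms(2-4)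
    by (auto dest: inj_onD)
  ultimately show ?thesis by (rule leaves_disjoint[OF T(1)])
qed

section \<open>Discrete functions on refined partitions\<close>

lemma local_spaces_degree_mono:
  fixes d d' :: nat
  assumes Z: "local_spaces S ZK ZD" and "K \<in> master_tree S" and "1 \<le> d" and "d \<le> d'"
  shows "ZD (K, d) \<subseteq> ZD (K, d')"
  using \<open>d \<le> d'\<close>
proof (induction d' rule: dec_induct)
  case (step n)
  then have "ZD (K, n) \<subseteq> ZD (K, Suc n)"
    using Z assms(2,3) unfolding local_spaces_def by (metis Suc_eq_plus1 le_trans)
  then show ?case using step by blast
qed simp

lemma local_spaces_functions_on:
  assumes "local_spaces S ZK ZD" and "K \<in> master_tree S" and "1 \<le> d"
  shows "ZD (K, d) \<subseteq> functions_on K"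
  using assms unfolding local_spaces_def by blast

lemma local_spaces_descendant:
  assumes Z: "local_spaces S ZK ZD" and KL: "(K, L) \<in> (parent_rel S)\<^sup>*"
    and K: "K \<in> master_tree S" and d: "1 \<le> d" and g: "g \<in> ZD (K, d)"
  shows "restr L g \<in> ZD (L, d)"
  using KL
proof induction
  case base
  have "restr K g = g"
    using local_spaces_functions_on[OF Z K d] g by (auto simp: functions_on_def)
  then show ?case using g by simp
next
  case (step M L)
  have "M \<in> master_tree S" and L: "L \<in> {child1 S M, child2 S M}"
    using step(2) by (auto simp: parent_rel_def)
  then have "ZD (M, d) \<subseteq> pw_product {child1 S M, child2 S M} (\<lambda>K'. K') (\<lambda>K'. ZD (K', d))"
    using Z d unfolding local_spaces_def by blast
  then have "restr L (restr M g) \<in> ZD (L, d)"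
    using step(3) L by (auto simp: pw_product_def)
  then show ?case
    using child_subset[OF step(2)] by (simp add: restr_restr Int_absorb2)
qed

text \<open>This is the inclusion \<open>Z\<^sub>\<D> \<subseteq> Z\<^sub>\<D>\<^sub>'\<close> for a refinement \<open>\<D>'\<close> of \<open>\<D>\<close>, for an
  element of \<open>Z\<^sub>\<D>\<close> given by its local pieces: on an element of \<open>\<D>'\<close> the sum coincides with the
  piece that belongs to its ancestor in \<open>\<D>\<close>, and the local dimension there is at least as large.\<close>

lemma glob_sum_refine:
  assumes Z: "local_spaces S ZK ZD"
    and \<D>: "\<D> \<in> hp_partitions S" and \<D>': "\<D>' \<in> hp_partitions S" and le: "hp_le S \<D> \<D>'"
    and g: "\<And>D. D \<in> \<D> \<Longrightarrow> g D \<in> ZD D"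
  shows "(\<Sum>D\<in>\<D>. g D) \<in> glob ZD \<D>'"
proof -
  have gf: "g D \<in> functions_on (fst D)" if "D \<in> \<D>" for D
    using local_spaces_functions_on[OF Z hp_partitionsD(1,2)[OF \<D> that]] g[OF that] by auto
  have "g D \<in> functions_on (closure (Om S))" if "D \<in> \<D>" for D
    by (rule functions_on_mono[OF _ gf[OF that]]) (use Union_hp_partition[OF \<D>] that in blast)
  then have "(\<Sum>D\<in>\<D>. g D) \<in> functions_on (\<Union>D'\<in>\<D>'. fst D')"
    unfolding Union_hp_partition[OF \<D>'] by (rule functions_on_sum)
  moreover have "restr (fst D') (\<Sum>D\<in>\<D>. g D) \<in> ZD D'" if D': "D' \<in> \<D>'" for D'
  proof -
    obtain D where D: "D \<in> \<D>" and anc: "fst D = fst D' \<or> ancestor S (fst D) (fst D')"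
      using le D' unfolding hp_le_def h_le_def by fastforce
    have deg: "snd D \<le> snd D'" using le D D' anc unfolding hp_le_def by blast
    have path: "(fst D, fst D') \<in> (parent_rel S)\<^sup>*"
      using anc by (auto simp: ancestor_def)
    have "restr (fst D) (\<Sum>D\<in>\<D>. g D) = g D"
      using finite_hp_partition[OF \<D>] D gf hp_partition_disjoint[OF \<D> D]
      by (intro restr_sum_disjoint) auto
    then have "restr (fst D') (\<Sum>D\<in>\<D>. g D) = restr (fst D') (g D)"
      using descendant_subset[OF path]
        restr_restr[of "fst D'" "fst D" "\<Sum>D\<in>\<D>. g D"] by (simp add: Int_absorb2)
    also have "\<dots> \<in> ZD (fst D', snd D)"
      using local_spaces_descendant[OF Z path hp_partitionsD(1,2)[OF \<D> D]] g[OF D] by simp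
    also have "\<dots> \<subseteq> ZD D'"
      using local_spaces_degree_mono[OF Z hp_partitionsD(1)[OF \<D>' D']
          hp_partitionsD(2)[OF \<D> D] deg] by simp
    finally show ?thesis .
  qed
  ultimately show ?thesis by (simp add: glob_def pw_product_def)
qed

lemma subspace_V: "subspace (spV S)"
  using V_hilbert unfolding hilbert_on_def by (rule conjunct1)

lemma projected_data_discrete:
  assumes "f \<in> spF S" "l \<in> Lam S"
    and \<D>: "\<D> \<in> hp_partitions S" and \<D>': "\<D>' \<in> hp_partitions S" "hp_le S \<D> \<D>'"
  shows "dataF S \<D> f l \<in> glob (discF S) \<D>'" "dataL S \<D> f l \<in> glob (discL S) \<D>'"
proof -
  have "0 \<in> spV S" by (rule subspace_0[OF subspace_V])
  then have range: "projQ S D (0, f, l) \<in> discV S D \<times> discF S D \<times> discL S D" if "D \<in> \<D>" for D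
    using proj_range[OF hp_partitionsD(1,2)[OF \<D> that], of "(0, f, l)"] assms(1,2) by simp
  show "dataF S \<D> f l \<in> glob (discF S) \<D>'"
    unfolding dataF_def
    by (rule glob_sum_refine[OF local_F \<D> \<D>']) (use range in \<open>simp add: mem_Times_iff\<close>)
  show "dataL S \<D> f l \<in> glob (discL S) \<D>'"
    unfolding dataL_def
    by (rule glob_sum_refine[OF local_L \<D> \<D>']) (use range in \<open>simp add: mem_Times_iff\<close>)
qed

lemma glob_subset_product:
  assumes Z: "local_spaces S ZK ZD" and \<D>: "\<D> \<in> hp_partitions S"
  shows "glob ZD \<D> \<subseteq> pw_product (fst ` \<D>) (\<lambda>K. K) ZK"
proof (rule glob_subset_pw_product)
  fix D assume "D \<in> \<D>"
  then show "ZD D \<subseteq> ZK (fst D)"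
    using Z hp_partitionsD(1,2)[OF \<D>] unfolding local_spaces_def by (metis prod.collapse)
qed

lemma glob_discF_subset: "\<D> \<in> hp_partitions S \<Longrightarrow> glob (discF S) \<D> \<subseteq> spF S"
  using glob_subset_product[OF local_F] F_product[OF hp_partitions_h_partition] by blast

lemma glob_discL_subset: "\<D> \<in> hp_partitions S \<Longrightarrow> glob (discL S) \<D> \<subseteq> LamBar S"
  using glob_subset_product[OF local_L] Lam_product[OF hp_partitions_h_partition] by blast

section \<open>One step of the algorithm\<close>

lemma sol_in_V:
  assumes "f \<in> spF S" "l \<in> LamBar S"
  shows "sol S f l \<in> spV S"
  using theI'[OF unique_solution[OF assms]] by (simp add: sol_def)

lemma Err_nonneg:
  assumes "\<D> \<in> hp_partitions S" "v \<in> spV S" "f \<in> spF S" "l \<in> Lam S"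
  shows "0 \<le> Err S \<D> v f l"
  unfolding Err_def
proof (rule sum_nonneg)
  fix D assume D: "D \<in> \<D>"
  show "0 \<le> locerr S D (v, f, l)"
    using err_nonneg[OF hp_partitionsD(1,2)[OF assms(1) D], where x = "(v, f, l)"] assms(2-4)
    by simp
qed

lemma Inf_Err_le:
  assumes "\<D> \<in> hp_partitions S" "v \<in> spV S" "f \<in> spF S" "l \<in> Lam S"
  shows "(INF w\<in>spV S. sqrt (Err S \<D> w f l)) \<le> sqrt (Err S \<D> v f l)"
proof (rule cINF_lower[OF _ assms(2)])
  show "bdd_below ((\<lambda>w. sqrt (Err S \<D> w f l)) ` spV S)"
    by (rule bdd_belowI[of _ 0]) (use Err_nonneg[OF assms(1) _ assms(3,4)] in auto)
qed

text \<open>The stability constant \<open>C1\<close> is paired with an infimum over \<open>V\<close>, so the tolerance \<open>\<delta>\<close> that was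
  met for the current iterate \<open>v\<close> already controls the change of the exact solution.\<close>

lemma AFEM_step:
  assumes nearbest: "is_hp_NEARBEST S b B NB" and pde: "is_PDE S PDE" and C1: "0 < C1"
    and stab: "\<And>\<D>. \<D> \<in> hp_partitions S \<Longrightarrow>
      normV S (sol S f l - sol S (dataF S \<D> f l) (dataL S \<D> f l))
        \<le> C1 * (INF w\<in>spV S. sqrt (Err S \<D> w f l))"
    and data: "f \<in> spF S" "l \<in> Lam S" and v: "v \<in> spV S" and pos: "0 < \<delta>" "0 < \<eta>"
    and NB: "(\<D>, fD, lD) = NB \<delta> v f l"
    and PDE: "(\<D>bar, w) = PDE \<eta> (confmap S \<D>) fD lD"
  shows "\<D> \<in> hp_partitions S" "sqrt (Err S \<D> v f l) \<le> \<delta>"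
    and "\<And>\<D>'. \<D>' \<in> hp_partitions S \<Longrightarrow> sqrt (Err S \<D>' v f l) \<le> b * \<delta> \<Longrightarrow>
      real (hp_card \<D>) \<le> B * real (hp_card \<D>')"
    and "w \<in> spV S" "normV S (sol S f l - w) \<le> C1 * \<delta> + \<eta>"
proof -
  show \<D>: "\<D> \<in> hp_partitions S" and err: "sqrt (Err S \<D> v f l) \<le> \<delta>"
    and "\<And>\<D>'. \<D>' \<in> hp_partitions S \<Longrightarrow> sqrt (Err S \<D>' v f l) \<le> b * \<delta> \<Longrightarrow>
      real (hp_card \<D>) \<le> B * real (hp_card \<D>')"
    using nearbest NB v data pos unfolding is_hp_NEARBEST_def by force+
  have eqs: "fD = dataF S \<D> f l" "lD = dataL S \<D> f l"
    using nearbest NB v data pos unfolding is_hp_NEARBEST_def by force+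
  define \<D>c where "\<D>c = confmap S \<D>"
  have c: "\<D>c \<in> confD S" "\<D>c \<in> hp_partitions S" "hp_le S \<D> \<D>c"
    using confmap[OF \<D>] confD_subset by (auto simp: \<D>c_def)
  have disc: "fD \<in> glob (discF S) \<D>c" "lD \<in> glob (discL S) \<D>c"
    using projected_data_discrete[OF data \<D> c(2,3)] by (simp_all add: eqs)
  have solD: "sol S fD lD \<in> spV S"
    using disc glob_discF_subset[OF c(2)] glob_discL_subset[OF c(2)] by (blast intro: sol_in_V)
  obtain \<D>' w' where w': "w' \<in> confV S \<D>'" "PDE \<eta> \<D>c fD lD = (\<D>', w')"
    and near: "normV S (sol S fD lD - w') \<le> \<eta>"
    using pde pos(2) c(1) disc unfolding is_PDE_def by meson
  have eq: "w' = w" using PDE w'(2) by (simp add: \<D>c_def)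
  show w: "w \<in> spV S" using w'(1) eq by (simp add: confV_def)
  have u: "sol S f l \<in> spV S" using data Lam_subset by (blast intro: sol_in_V)
  have "normV S (sol S f l - w) \<le> normV S (sol S f l - sol S fD lD) + normV S (sol S fD lD - w)"
    using hilbert_on_triangle[OF V_hilbert subspace_diff[OF subspace_V u solD]
        subspace_diff[OF subspace_V solD w]] by (simp add: normV_def)
  moreover have "normV S (sol S f l - sol S fD lD) \<le> C1 * \<delta>"
  proof -
    have "normV S (sol S f l - sol S fD lD) \<le> C1 * (INF w\<in>spV S. sqrt (Err S \<D> w f l))"
      using stab[OF \<D>] by (simp add: eqs)
    also have "\<dots> \<le> C1 * \<delta>"
      by (rule mult_left_mono[OF order_trans[OF Inf_Err_le[OF \<D> v data] err]]) (use C1 in simp)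
    finally show ?thesis .
  qed
  ultimately show "normV S (sol S f l - w) \<le> C1 * \<delta> + \<eta>" using near eq by simp
qed

end

section \<open>Convergence and near-optimality\<close>

theorem theorem2p1:
  fixes S :: "('a::euclidean_space, 'v::real_vector, 'f::real_vector, 'l::real_vector, 'y) hp_data"
    and b B C1 C2 \<mu> \<omega> \<epsilon>0 :: real
  assumes framework: "hp_framework S"
    and b_B: "0 < b" "b \<le> 1" "1 \<le> B"
    and nearbest: "is_hp_NEARBEST S b B NB"
    and pde: "is_PDE S PDE"
    and C: "0 < C1" "0 < C2" "C1 * C2 < b"
    and data_stability:
      "\<forall>\<D>\<in>hp_partitions S. \<forall>f\<in>spF S. \<forall>l\<in>Lam S.
         normV S (sol S f l - sol S (dataF S \<D> f l) (dataL S \<D> f l))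
           \<le> C1 * (INF w\<in>spV S. sqrt (Err S \<D> w f l))"
    and error_lipschitz:
      "\<forall>\<D>\<in>hp_partitions S. \<forall>v\<in>spV S. \<forall>w\<in>spV S.
         (SUP (f, l)\<in>spF S \<times> Lam S. ereal \<bar>sqrt (Err S \<D> w f l) - sqrt (Err S \<D> v f l)\<bar>)
           \<le> ereal (C2 * normV S (w - v))"
    and data: "f \<in> spF S" "l \<in> Lam S"
    and u: "u = sol S f l"
    and start: "ubar0 \<in> spV S" "0 < \<epsilon>0" "normV S (u - ubar0) \<le> \<epsilon>0"
    and \<mu>: "\<mu> \<in> {0<..<1}"
    and \<omega>: "0 < \<omega>" "C1 * C2 < b * (1 - \<mu>)" "\<omega> \<in> {C2 / b<..<(1 - \<mu>) / C1}"
    and run: "hp_AFEM S NB PDE C1 \<mu> \<omega> ubar0 f l \<epsilon>0 Ds Dbar ubar \<epsilon>"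
  shows "(\<forall>i. \<epsilon> i = (\<mu> + C1 * \<omega>) ^ i * \<epsilon>0) \<and>
    (\<forall>i. normV S (u - ubar i) \<le> \<epsilon> i) \<and>
    (\<forall>i\<ge>1. sqrt (Err S (Ds i) u f l) \<le> (\<omega> + C2) * \<epsilon> (i - 1)) \<and>
    (\<forall>i\<ge>1. \<forall>\<D>\<in>hp_partitions S. sqrt (Err S \<D> u f l) \<le> (b * \<omega> - C2) * \<epsilon> (i - 1) \<longrightarrow>
       real (hp_card (Ds i)) \<le> B * real (hp_card \<D>))"
proof -
  interpret hp_framework S by (rule framework)
  have uV: "u \<in> spV S" using data Lam_subset u by (blast intro: sol_in_V)
  have stab: "\<And>\<D>. \<D> \<in> hp_partitions S \<Longrightarrow>
      normV S (sol S f l - sol S (dataF S \<D> f l) (dataL S \<D> f l))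
        \<le> C1 * (INF w\<in>spV S. sqrt (Err S \<D> w f l))"
    using data_stability data by blast
  have lip: "\<bar>sqrt (Err S \<D> u f l) - sqrt (Err S \<D> v f l)\<bar> \<le> C2 * e"
    if \<D>: "\<D> \<in> hp_partitions S" and v: "v \<in> spV S" and e: "normV S (u - v) \<le> e" for \<D> v e
  proof -
    have "ereal \<bar>sqrt (Err S \<D> u f l) - sqrt (Err S \<D> v f l)\<bar>
        \<le> (SUP (f, l)\<in>spF S \<times> Lam S. ereal \<bar>sqrt (Err S \<D> u f l) - sqrt (Err S \<D> v f l)\<bar>)"
      by (rule SUP_upper2[of "(f, l)"]) (use data in auto)
    also have "\<dots> \<le> ereal (C2 * normV S (u - v))"
      using error_lipschitz \<D> v uV by blast
    finally have "\<bar>sqrt (Err S \<D> u f l) - sqrt (Err S \<D> v f l)\<bar> \<le> C2 * normV S (u - v)" by simp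
    also have "\<dots> \<le> C2 * e" using e C(2) by simp
    finally show ?thesis .
  qed
  have init: "ubar 0 = ubar0" "\<epsilon> 0 = \<epsilon>0"
    and step: "\<And>i. \<exists>fD lD. (Ds (Suc i), fD, lD) = NB (\<omega> * \<epsilon> i) (ubar i) f l \<and>
        (Dbar (Suc i), ubar (Suc i)) = PDE (\<mu> * \<epsilon> i) (confmap S (Ds (Suc i))) fD lD"
    and eps_Suc: "\<And>i. \<epsilon> (Suc i) = (\<mu> + C1 * \<omega>) * \<epsilon> i"
    using run unfolding hp_AFEM_def by (metis diff_Suc_1 le_add1 plus_1_eq_Suc)+
  have eps: "\<epsilon> i = (\<mu> + C1 * \<omega>) ^ i * \<epsilon>0" for i
    by (induction i) (simp_all add: init eps_Suc)
  have eps_pos: "0 < \<epsilon> i" for i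
    using \<mu> \<omega>(1) C(1) start(2) by (simp add: eps add_pos_pos)
  have one_step:
    "Ds (Suc i) \<in> hp_partitions S \<and> sqrt (Err S (Ds (Suc i)) (ubar i) f l) \<le> \<omega> * \<epsilon> i \<and>
     (\<forall>\<D>'\<in>hp_partitions S. sqrt (Err S \<D>' (ubar i) f l) \<le> b * (\<omega> * \<epsilon> i) \<longrightarrow>
       real (hp_card (Ds (Suc i))) \<le> B * real (hp_card \<D>')) \<and>
     ubar (Suc i) \<in> spV S \<and> normV S (u - ubar (Suc i)) \<le> \<epsilon> (Suc i)"
    if v: "ubar i \<in> spV S" for i
  proof -
    obtain fD lD where NB: "(Ds (Suc i), fD, lD) = NB (\<omega> * \<epsilon> i) (ubar i) f l"
      and PDE: "(Dbar (Suc i), ubar (Suc i)) = PDE (\<mu> * \<epsilon> i) (confmap S (Ds (Suc i))) fD lD"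
      using step by blast
    have pos: "0 < \<omega> * \<epsilon> i" "0 < \<mu> * \<epsilon> i" using \<omega>(1) \<mu> eps_pos by simp_all
    have "C1 * (\<omega> * \<epsilon> i) + \<mu> * \<epsilon> i = \<epsilon> (Suc i)" by (simp add: eps_Suc algebra_simps)
    then show ?thesis
      using AFEM_step[OF nearbest pde C(1) stab data v pos NB PDE] by (simp add: u)
  qed
  have inv: "ubar i \<in> spV S \<and> normV S (u - ubar i) \<le> \<epsilon> i" for i
    by (induction i) (use init start one_step in auto)
  have "sqrt (Err S (Ds (Suc i)) u f l) \<le> (\<omega> + C2) * \<epsilon> i" for i
    using one_step[of i] inv[of i] lip[of "Ds (Suc i)" "ubar i" "\<epsilon> i"]
    by (auto simp: algebra_simps)
  moreover have "real (hp_card (Ds (Suc i))) \<le> B * real (hp_card \<D>)"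
    if \<D>: "\<D> \<in> hp_partitions S" and E: "sqrt (Err S \<D> u f l) \<le> (b * \<omega> - C2) * \<epsilon> i" for \<D> i
  proof -
    have "sqrt (Err S \<D> (ubar i) f l) \<le> b * (\<omega> * \<epsilon> i)"
      using E lip[OF \<D>, of "ubar i" "\<epsilon> i"] inv[of i] by (auto simp: algebra_simps)
    then show ?thesis using one_step[of i] inv[of i] \<D> by blast
  qed
  ultimately show ?thesis
    using eps inv by (metis Suc_diff_1 less_eq_Suc_le One_nat_def)
qed

end
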